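(* Let $k\ge 1$, $n=2^k-1$, $m\ge 1$, let $B\in\mathbb{R}^{m\times m}$ be a tridiagonal matrix, and let $\mathcal{R}_n\in\mathbb{R}^{n\times n}$ be the tridiagonal matrix with diagonal entries $b_1,\dots,b_n$, subdiagonal entries $a_2,\dots,a_n$ ($a_i$ in position $(i,i-1)$) and superdiagonal entries $c_1,\dots,c_{n-1}$ ($c_i$ in position $(i,i+1)$). For $r=0,1,\dots,k-1$ and $i=2^r,2\cdot 2^r,\dots,(2^{k-r}-1)\cdot 2^r$, let $\mathcal{R}_i^{(r)}$ be the negative of the principal submatrix of $\mathcal{R}_n$ formed by the rows and columns with indices $i-(2^r-1),\dots,i+(2^r-1)$, and let $$f_i^{(r)}(x)=\det\left(xI-\mathcal{R}_i^{(r)}\right)$$ be its eigenpolynomial (characteristic polynomial). Then, for all such $r$ and $i$, the matrix polynomial $B_i^{(r)}$ (defined recursively in the context) satisfies $$B_i^{(r)}=(-1)^r f_i^{(r)}(B),$$ as polynomials in $B$.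
   Context: Set $a_1=0$, $c_n=0$, and $$\alpha_i^{(s)}=\prod_{j=i-2^s+1}^{i}a_j,\qquad \gamma_i^{(s)}=\prod_{j=i}^{i+2^s-1}c_j .$$ The matrix polynomials $B_i^{(r)}$ of the extended cyclic reduction algorithm are defined by $B_i^{(-1)}=I$ (for every index, including fractional ones that occur when $r=1$), $B_i^{(0)}=B+b_iI$ for $i=1,\dots,n$, and, for $r=1,\dots,k-1$ and $i=2^r,2\cdot2^r,\dots,(2^{k-r}-1)\cdot2^r$, $$B_i^{(r)}=\big(\mathcal{D}_i^{(r)}\big)^{-1}\Big(\alpha_i^{(r-1)}\gamma_{i-2^{r-1}}^{(r-1)}B_{i+2^{r-2}}^{(r-2)}B_{i-3\cdot2^{r-2}}^{(r-2)}B_{i+2^{r-1}}^{(r-1)}-B_{i-2^{r-1}}^{(r-1)}B_i^{(r-1)}B_{i+2^{r-1}}^{(r-1)}+\alpha_{i+2^{r-1}}^{(r-1)}\gamma_i^{(r-1)}B_{i-2^{r-2}}^{(r-2)}B_{i+3\cdot2^{r-2}}^{(r-2)}B_{i-2^{r-1}}^{(r-1)}\Big),$$ where $\mathcal{D}_i^{(r)}=B_{i-2^{r-2}}^{(r-2)}B_{i+2^{r-2}}^{(r-2)}$. Convention: $B_i^{(r)}$ is regarded as a polynomial in the matrix $B$. The corresponding scalar polynomial is obtained from the same recursion with $B$ replaced by an indeterminate $x$ and $I$ by $1$, where multiplication by $(\mathcal{D}_i^{(r)})^{-1}$ means division in the field of rational functions $\mathbb{R}(x)$. The theorem asserts that this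 scalar function equals $(-1)^rf_i^{(r)}(x)$. *)

theory Defs
  imports
    "Jordan_Normal_Form.Char_Poly"
    "Jordan_Normal_Form.DL_Submatrix"
    "HOL-Computational_Algebra.Polynomial_Factorial"
begin

definition tridiagonal_mat :: "'a :: zero mat \<Rightarrow> bool" where
  "tridiagonal_mat A \<longleftrightarrow>
     (\<forall>p < dim_row A. \<forall>q < dim_col A. p + 1 < q \<or> q + 1 < p \<longrightarrow> A $$ (p, q) = 0)"

(* The coefficient sequences a, b, c are indexed from 1, as in the mathematics, whereas rows and
   columns of matrices are indexed from 0: row p carries a (p + 1), b (p + 1), c (p + 1). *)
definition R_mat ::
  "(nat \<Rightarrow> real) \<Rightarrow> (nat \<Rightarrow> real) \<Rightarrow> (nat \<Rightarrow> real) \<Rightarrow> nat \<Rightarrow> real mat" where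
  "R_mat a b c n = mat n n (\<lambda>(p, q).
     if p = q then b (p + 1)
     else if p = q + 1 then a (p + 1)
     else if q = p + 1 then c (p + 1)
     else 0)"

(* The 1-based indices i - (2^r - 1), ..., i + (2^r - 1) are i - 2^r, ..., i + 2^r - 2 when counted
   from 0. No truncation of the subtraction occurs, since only i \<ge> 2^r is of interest. *)
definition R_sub ::
  "(nat \<Rightarrow> real) \<Rightarrow> (nat \<Rightarrow> real) \<Rightarrow> (nat \<Rightarrow> real) \<Rightarrow> nat \<Rightarrow> nat \<Rightarrow> nat \<Rightarrow> real mat" where
  "R_sub a b c n r i =
     (let J = {i - 2 ^ r ..< i + 2 ^ r - 1} in - submatrix (R_mat a b c n) J J)"

definition eigenpoly ::
  "(nat \<Rightarrow> real) \<Rightarrow> (nat \<Rightarrow> real) \<Rightarrow> (nat \<Rightarrow> real) \<Rightarrow> nat \<Rightarrow> nat \<Rightarrow> nat \<Rightarrow> real poly" where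
  "eigenpoly a b c n r i = char_poly (R_sub a b c n r i)"

definition ecr_alpha :: "(nat \<Rightarrow> real) \<Rightarrow> nat \<Rightarrow> nat \<Rightarrow> real" where
  "ecr_alpha a s i = (\<Prod>j = i + 1 - 2 ^ s..i. a j)"

definition ecr_gamma :: "(nat \<Rightarrow> real) \<Rightarrow> nat \<Rightarrow> nat \<Rightarrow> real" where
  "ecr_gamma c s i = (\<Prod>j = i..i + 2 ^ s - 1. c j)"

(* The superscript is shifted by one, so that ecr_shift a b c s i is the rational function B_i^(s-1)
   in R(x): s = 0 is B^(-1) = 1, s = 1 is B^(0) = x + b_i, and in the last equation r = s + 1, so
   h = 2^(r-1) and q = 2^(r-2). For r = 1 the number 2^(r-2) = 1/2 is replaced by q = 0, which is
   harmless because it occurs only in indices of B^(-1), which is 1 for every index. *)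
fun ecr_shift ::
  "(nat \<Rightarrow> real) \<Rightarrow> (nat \<Rightarrow> real) \<Rightarrow> (nat \<Rightarrow> real) \<Rightarrow> nat \<Rightarrow> nat \<Rightarrow> real poly fract" where
  "ecr_shift a b c 0 i = 1"
| "ecr_shift a b c (Suc 0) i = to_fract [:b i, 1:]"
| "ecr_shift a b c (Suc (Suc s)) i =
     (let h = 2 ^ s; q = 2 ^ s div 2 in
       (to_fract [:ecr_alpha a s i * ecr_gamma c s (i - h):]
          * ecr_shift a b c s (i + q) * ecr_shift a b c s (i - 3 * q)
          * ecr_shift a b c (Suc s) (i + h)
        - ecr_shift a b c (Suc s) (i - h) * ecr_shift a b c (Suc s) i
          * ecr_shift a b c (Suc s) (i + h)
        + to_fract [:ecr_alpha a s (i + h) * ecr_gamma c s i:]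
          * ecr_shift a b c s (i - q) * ecr_shift a b c s (i + 3 * q)
          * ecr_shift a b c (Suc s) (i - h))
       / (ecr_shift a b c s (i - q) * ecr_shift a b c s (i + q)))"

definition ecr_B ::
  "(nat \<Rightarrow> real) \<Rightarrow> (nat \<Rightarrow> real) \<Rightarrow> (nat \<Rightarrow> real) \<Rightarrow> nat \<Rightarrow> nat \<Rightarrow> real poly fract" where
  "ecr_B a b c r i = ecr_shift a b c (Suc r) i"

definition mat_poly :: "'a :: comm_ring_1 poly \<Rightarrow> 'a mat \<Rightarrow> 'a mat" where
  "mat_poly p A = mat (dim_row A) (dim_row A)
     (\<lambda>(u, v). \<Sum>d\<le>degree p. coeff p d * (A ^\<^sub>m d) $$ (u, v))"

(* The matrix polynomial B_i^(r) evaluated at the matrix: the polynomial is the one whose image in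
   R(x) is the result of the recursion (unique, as to_fract is injective). *)
definition ecr_B_mat ::
  "(nat \<Rightarrow> real) \<Rightarrow> (nat \<Rightarrow> real) \<Rightarrow> (nat \<Rightarrow> real) \<Rightarrow> real mat \<Rightarrow> nat \<Rightarrow> nat \<Rightarrow> real mat" where
  "ecr_B_mat a b c B r i = mat_poly (THE p. to_fract p = ecr_B a b c r i) B"

end

theory Submission
  imports Defs
begin

text \<open>
  The entries of the recursion are continuants of the tridiagonal matrix, with \<open>a\<^sub>j c\<^sub>j\<^sub>-\<^sub>1\<close> as the
  weight of the link between \<open>j - 1\<close> and \<open>j\<close>. Write \<open>F[l..u]\<close> for the continuant of the indices
  \<open>l, \<dots>, u\<close>. Splitting \<open>F[i-2h+1..i+2h-1]\<close> and \<open>F[i-h+1..i+h-1]\<close> at the index \<open>i\<close>, the defect between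
  \<open>F[i-h+1..i-1] F[i+1..i+h-1] F[i-2h+1..i+2h-1]\<close> and
  \<open>F[i-2h+1..i-1] F[i-h+1..i+h-1] F[i+1..i+2h-1]\<close> is a combination of two expressions that
  Euler's continuant identity evaluates; they are the products of the weights that occur in
  the recursion.
\<close>

section \<open>Continuants and Euler's identity\<close>

text \<open>\<open>continuant d e l n\<close> is the continuant of the \<open>n - 1\<close> indices \<open>l, \<dots>, l + n - 2\<close>. The shift makes
  room for the value 0 that continues the recurrence below the empty continuant 1.\<close>

fun continuant :: "(nat \<Rightarrow> 'a) \<Rightarrow> (nat \<Rightarrow> 'a) \<Rightarrow> nat \<Rightarrow> nat \<Rightarrow> 'a :: comm_ring_1" where
  "continuant d e l 0 = 0"
| "continuant d e l (Suc 0) = 1"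
| "continuant d e l (Suc (Suc n)) =
     d (l + n) * continuant d e l (Suc n) - e (l + n) * continuant d e l n"

text \<open>Both sides obey the same three-term recurrence in \<open>t\<close>. The subtracted term
  is the contribution of the link that is cut, between \<open>l + s - 1\<close> and
  \<open>l + s\<close>.\<close>

lemma continuant_split:
  "continuant d e l (Suc (s + t)) =
     continuant d e l (Suc s) * continuant d e (l + s) (Suc t)
     - e (l + s) * continuant d e l s * continuant d e (Suc (l + s)) t"
proof (induction t rule: induct_nat_012)
  case (ge2 t)
  have "continuant d e l (Suc (s + Suc (Suc t))) =
      d (l + s + Suc t) * continuant d e l (Suc (s + Suc t))
      - e (l + s + Suc t) * continuant d e l (Suc (s + t))"
    by (simp add: add.assoc)
  then show ?case
    unfolding ge2 by (simp add: algebra_simps)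
qed simp_all

lemma continuant_front:
  "continuant d e l (Suc (Suc t)) =
     d l * continuant d e (Suc l) (Suc t) - e (Suc l) * continuant d e (Suc (Suc l)) t"
  using continuant_split[of d e l "Suc 0" t] by simp

text \<open>Both continuants solve one recurrence in \<open>s\<close>, so the left side is a
  Casorati determinant: in each step the \<open>d\<close>-terms cancel and a factor
  \<open>e (l + p + s)\<close> comes out.\<close>

lemma continuant_euler_left:
  "continuant d e (l + p) (Suc s) * continuant d e l (p + s)
     - continuant d e (l + p) s * continuant d e l (Suc (p + s)) =
   (\<Prod>j<s. e (l + p + j)) * continuant d e l p"
proof (induction s)
  case (Suc s)
  have "continuant d e (l + p) (Suc (Suc s)) * continuant d e l (p + Suc s)
     - continuant d e (l + p) (Suc s) * continuant d e l (Suc (p + Suc s)) =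
     e (l + p + s) * (continuant d e (l + p) (Suc s) * continuant d e l (p + s)
     - continuant d e (l + p) s * continuant d e l (Suc (p + s)))"
    by (simp add: algebra_simps)
  then show ?case
    unfolding Suc by (simp add: algebra_simps)
qed simp

text \<open>Mirror image of \<open>continuant_euler_left\<close>: indices are peeled off the front,
  so \<open>l\<close> moves in the induction.\<close>

lemma continuant_euler_right:
  "continuant d e l (Suc s) * continuant d e (Suc l) (s + p)
     - continuant d e (Suc l) s * continuant d e l (Suc (s + p)) =
   (\<Prod>j<s. e (Suc l + j)) * continuant d e (Suc l + s) p"
proof (induction s arbitrary: l)
  case (Suc s)
  have "continuant d e l (Suc (Suc s)) * continuant d e (Suc l) (Suc s + p)
     - continuant d e (Suc l) (Suc s) * continuant d e l (Suc (Suc s + p)) =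
     e (Suc l) * (continuant d e (Suc l) (Suc s) * continuant d e (Suc (Suc l)) (s + p)
     - continuant d e (Suc (Suc l)) s * continuant d e (Suc l) (Suc (s + p)))"
    by (simp add: continuant_front del: continuant.simps(3)) (simp add: algebra_simps)
  then show ?case
    unfolding Suc by (simp add: prod.lessThan_Suc_shift algebra_simps del: prod.lessThan_Suc)
qed simp

text \<open>The index \<open>l + s\<close> stands alone, or is linked to its left neighbour, or to
  its right one.\<close>

lemma continuant_middle:
  "continuant d e l (Suc (s + Suc t)) =
     d (l + s) * continuant d e l (Suc s) * continuant d e (Suc (l + s)) (Suc t)
     - e (l + s) * continuant d e l s * continuant d e (Suc (l + s)) (Suc t)
     - e (Suc (l + s)) * continuant d e l (Suc s) * continuant d e (Suc (Suc (l + s))) t"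
  unfolding continuant_split[of d e l s "Suc t"] continuant_front[of d e "l + s" t]
  by (simp add: algebra_simps)

text \<open>The recursion without signs and cleared of denominators: \<open>4 * h\<close>,
  \<open>2 * h\<close> and \<open>h\<close> belong to three consecutive levels.\<close>

lemma continuant_cyclic_reduction:
  assumes "0 < h"
  shows "continuant d e (l + h) h * continuant d e (l + 2 * h) h * continuant d e l (4 * h) =
    continuant d e l (2 * h) * continuant d e (l + h) (2 * h) * continuant d e (l + 2 * h) (2 * h)
    - (\<Prod>j<h. e (l + h + j)) * continuant d e (l + 2 * h) h * continuant d e l h
        * continuant d e (l + 2 * h) (2 * h)
    - (\<Prod>j<h. e (l + 2 * h + j)) * continuant d e (l + h) h * continuant d e (l + 3 * h) h
        * continuant d e l (2 * h)"
proof -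
  obtain s where h: "h = Suc s"
    using assms gr0_implies_Suc by blast
  \<comment> \<open>Here \<open>t = 2 * h - 1\<close>, so \<open>l + t\<close> is the central index
    of both windows to be split, with \<open>t\<close> indices on either side in the long one and
    \<open>s\<close> in the short one.\<close>
  define t where "t = s + h"
  let ?i = "l + t"
  have outer: "continuant d e l (4 * h) =
      d ?i * continuant d e l (2 * h) * continuant d e (l + 2 * h) (2 * h)
      - e ?i * continuant d e l t * continuant d e (l + 2 * h) (2 * h)
      - e (l + 2 * h) * continuant d e l (2 * h) * continuant d e (Suc (l + 2 * h)) t"
    using continuant_middle[of d e l t t] unfolding t_def h by (simp add: eval_nat_numeral add_ac del: continuant.simps(3))
  have inner: "continuant d e (l + h) (2 * h) =
      d ?i * continuant d e (l + h) h * continuant d e (l + 2 * h) h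
      - e ?i * continuant d e (l + h) s * continuant d e (l + 2 * h) h
      - e (l + 2 * h) * continuant d e (l + h) h * continuant d e (Suc (l + 2 * h)) s"
    using continuant_middle[of d e "l + h" s s] unfolding t_def h by (simp add: eval_nat_numeral add_ac del: continuant.simps(3))
  have left: "continuant d e (l + h) h * continuant d e l t
      - continuant d e (l + h) s * continuant d e l (2 * h) =
      (\<Prod>j<s. e (l + h + j)) * continuant d e l h"
    using continuant_euler_left[of d e l h s] unfolding t_def h by (simp add: add_ac mult_2 del: continuant.simps(3))
  have right: "continuant d e (l + 2 * h) h * continuant d e (Suc (l + 2 * h)) t
      - continuant d e (Suc (l + 2 * h)) s * continuant d e (l + 2 * h) (2 * h) =
      (\<Prod>j<s. e (Suc (l + 2 * h + j))) * continuant d e (l + 3 * h) h"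
    using continuant_euler_right[of d e "l + 2 * h" s h] unfolding t_def h
    by (simp add: add_ac eval_nat_numeral del: continuant.simps(3))
  have prod_left: "(\<Prod>j<h. e (l + h + j)) = e ?i * (\<Prod>j<s. e (l + h + j))"
    unfolding h t_def by (simp add: add_ac)
  have prod_right: "(\<Prod>j<h. e (l + 2 * h + j)) =
      e (l + 2 * h) * (\<Prod>j<s. e (Suc (l + 2 * h + j)))"
    unfolding h by (subst prod.lessThan_Suc_shift) simp
  \<comment> \<open>Both products contain the same multiple of \<open>d ?i\<close>, which
    cancels.\<close>
  have "continuant d e (l + h) h * continuant d e (l + 2 * h) h * continuant d e l (4 * h)
      - continuant d e l (2 * h) * continuant d e (l + h) (2 * h) * continuant d e (l + 2 * h) (2 * h)
      = - e ?i * continuant d e (l + 2 * h) (2 * h) * continuant d e (l + 2 * h) h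
          * (continuant d e (l + h) h * continuant d e l t
             - continuant d e (l + h) s * continuant d e l (2 * h))
        - e (l + 2 * h) * continuant d e l (2 * h) * continuant d e (l + h) h
          * (continuant d e (l + 2 * h) h * continuant d e (Suc (l + 2 * h)) t
             - continuant d e (Suc (l + 2 * h)) s * continuant d e (l + 2 * h) (2 * h))"
    unfolding outer inner by (simp add: algebra_simps)
  then show ?thesis
    unfolding left right prod_left prod_right by (simp add: algebra_simps)
qed

section \<open>Determinants of tridiagonal matrices\<close>

definition tridiagonal :: "(nat \<Rightarrow> 'a) \<Rightarrow> (nat \<Rightarrow> 'a) \<Rightarrow> (nat \<Rightarrow> 'a) \<Rightarrow> nat \<Rightarrow> nat \<Rightarrow> 'a :: zero mat" where
  "tridiagonal a b c l n = mat n n (\<lambda>(p, q).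
     if p = q then b (l + p)
     else if p = q + 1 then a (l + p)
     else if q = p + 1 then c (l + p)
     else 0)"

lemma tridiagonal_carrier [simp]: "tridiagonal a b c l n \<in> carrier_mat n n"
  by (simp add: tridiagonal_def)

text \<open>Expansion along the last row; the last column of the off-diagonal minor
  \<open>?M\<close> holds only \<open>c (l + n)\<close>, so a second expansion finishes.\<close>

lemma det_tridiagonal_Suc_Suc:
  fixes a b c :: "nat \<Rightarrow> 'a :: comm_ring_1"
  shows "det (tridiagonal a b c l (Suc (Suc n))) =
    b (l + Suc n) * det (tridiagonal a b c l (Suc n))
    - a (l + Suc n) * c (l + n) * det (tridiagonal a b c l n)"
proof -
  let ?A = "tridiagonal a b c l (Suc (Suc n))"
  let ?M = "mat_delete ?A (Suc n) n"
  have A: "?A \<in> carrier_mat (Suc (Suc n)) (Suc (Suc n))" and M: "?M \<in> carrier_mat (Suc n) (Suc n)"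
    by (simp_all add: mat_delete_def tridiagonal_def)
  have minor: "mat_delete ?A (Suc n) (Suc n) = tridiagonal a b c l (Suc n)"
    "mat_delete ?M n n = tridiagonal a b c l n"
    by (rule eq_matI; auto simp: mat_delete_def tridiagonal_def)+
  have M_col: "?M $$ (p, n) = (if p = n then c (l + n) else 0)" if "p < Suc n" for p
    using that by (auto simp: mat_delete_def tridiagonal_def)
  have A_row: "?A $$ (Suc n, q) =
      (if q = Suc n then b (l + Suc n) else if q = n then a (l + Suc n) else 0)"
    if "q < Suc (Suc n)" for q
    using that by (auto simp: tridiagonal_def)
  have "det ?M = (\<Sum>p<Suc n. ?M $$ (p, n) * cofactor ?M p n)"
    using laplace_expansion_column[OF M] by simp
  also have "\<dots> = c (l + n) * det (tridiagonal a b c l n)"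
    using M_col by (simp add: cofactor_def minor)
  finally have det_M: "det ?M = c (l + n) * det (tridiagonal a b c l n)" .
  have "det ?A = (\<Sum>q<Suc (Suc n). ?A $$ (Suc n, q) * cofactor ?A (Suc n) q)"
    using laplace_expansion_row[OF A] by simp
  also have "\<dots> = a (l + Suc n) * cofactor ?A (Suc n) n + b (l + Suc n) * cofactor ?A (Suc n) (Suc n)"
    using A_row by simp
  finally show ?thesis
    by (simp add: cofactor_def minor det_M algebra_simps)
qed

text \<open>The truncation of \<open>j - 1\<close> at \<open>j = 0\<close> is harmless: that weight
  can only meet the value 0 of \<open>continuant\<close> at length 0.\<close>

lemma det_tridiagonal:
  fixes a b c :: "nat \<Rightarrow> 'a :: comm_ring_1"
  shows "det (tridiagonal a b c l n) = continuant b (\<lambda>j. a j * c (j - 1)) l (Suc n)"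
proof (induction n rule: induct_nat_012)
  case 0
  have "tridiagonal a b c l 0 \<in> carrier_mat 0 0"
    by simp
  then show ?case
    by simp
next
  case 1
  show ?case
    using det_single[of "tridiagonal a b c l 1"] by (simp add: tridiagonal_def)
next
  case (ge2 n)
  then show ?case
    unfolding det_tridiagonal_Suc_Suc by simp
qed

section \<open>Eigenpolynomials as continuants\<close>

definition eigencontinuant ::
  "(nat \<Rightarrow> real) \<Rightarrow> (nat \<Rightarrow> real) \<Rightarrow> (nat \<Rightarrow> real) \<Rightarrow> nat \<Rightarrow> nat \<Rightarrow> real poly" where
  "eigencontinuant a b c = continuant (\<lambda>j. [:b j, 1:]) (\<lambda>j. [:a j * c (j - 1):])"

lemma char_poly_uminus_tridiagonal:
  "char_poly (- tridiagonal a b c l n) = eigencontinuant a b c l (Suc n)"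
proof -
  have "char_poly_matrix (- tridiagonal a b c l n) =
      tridiagonal (\<lambda>j. [:a j:]) (\<lambda>j. [:b j, 1:]) (\<lambda>j. [:c j:]) l n"
    by (rule eq_matI) (auto simp: char_poly_matrix_def tridiagonal_def)
  then show ?thesis
    by (simp add: char_poly_def det_tridiagonal eigencontinuant_def mult.commute)
qed

text \<open>Characteristic polynomials are monic; this makes the divisors of the recursion
  nonzero.\<close>

lemma eigencontinuant_nonzero:
  assumes "0 < n"
  shows "eigencontinuant a b c l n \<noteq> 0"
proof -
  obtain m where n: "n = Suc m"
    using assms gr0_implies_Suc by blast
  have "- tridiagonal a b c l m \<in> carrier_mat m m"
    by simp
  then show ?thesis
    using degree_monic_char_poly[of "- tridiagonal a b c l m" m]
    unfolding char_poly_uminus_tridiagonal n by auto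
qed

lemma pick_atLeastLessThan:
  assumes "x + p < y"
  shows "pick {x..<y} p = x + p"
proof -
  have "{z \<in> {x..<y}. z < x + p} = {x..<x + p}"
    using assms by auto
  then show ?thesis
    using pick_card_in_set[of "x + p" "{x..<y}"] assms by simp
qed

lemma submatrix_R_mat:
  assumes "x + m \<le> n"
  shows "submatrix (R_mat a b c n) {x..<x + m} {x..<x + m} = tridiagonal a b c (Suc x) m"
proof -
  have "{p. p < n \<and> p \<in> {x..<x + m}} = {x..<x + m}"
    using assms by auto
  then have "card {p. p < n \<and> x \<le> p \<and> p < x + m} = m"
    by simp
  then show ?thesis
    using assms by (intro eq_matI) (auto simp: submatrix_def R_mat_def tridiagonal_def pick_atLeastLessThan)
qed

text \<open>The window has \<open>2 ^ Suc r - 1\<close> indices, which the shifted count of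
  \<open>continuant\<close> turns into \<open>2 ^ Suc r\<close>.\<close>

lemma eigenpoly_eq_eigencontinuant:
  assumes "2 ^ r \<le> i" and "i + 2 ^ r \<le> Suc n"
  shows "eigenpoly a b c n r i = eigencontinuant a b c (i + 1 - 2 ^ r) (2 ^ Suc r)"
proof -
  have pos: "(1 :: nat) \<le> 2 ^ r"
    by simp
  have "i + 2 ^ r - 1 = (i - 2 ^ r) + (2 ^ Suc r - 1)" and "(i - 2 ^ r) + (2 ^ Suc r - 1) \<le> n"
    and "i + 1 - 2 ^ r = Suc (i - 2 ^ r)" and "(2 :: nat) ^ Suc r = Suc (2 ^ Suc r - 1)"
    using assms pos by (simp_all del: one_le_numeral one_le_power)
  then show ?thesis
    unfolding eigenpoly_def R_sub_def Let_def
    by (metis submatrix_R_mat char_poly_uminus_tridiagonal)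
qed

section \<open>Solving the recursion\<close>

text \<open>The range of the \<open>c\<close>-factors lies one below that of the
  \<open>a\<close>-factors, so they pair up into link weights.\<close>

lemma ecr_alpha_times_gamma:
  assumes "2 ^ s \<le> i"
  shows "ecr_alpha a s i * ecr_gamma c s (i - 2 ^ s) =
    (\<Prod>j<2 ^ s. a (i + 1 - 2 ^ s + j) * c (i - 2 ^ s + j))"
proof -
  have shift: "(\<Prod>j = x..y. f j) = (\<Prod>j<m. f (x + j))" if "Suc y = x + m" for f :: "nat \<Rightarrow> real" and x y m
    using that prod.shift_bounds_nat_ivl[of f 0 x m]
    by (simp add: atLeastLessThanSuc_atLeastAtMost[symmetric] lessThan_atLeast0 add_ac)
  have "Suc i = i + 1 - 2 ^ s + 2 ^ s" and "Suc (i - 2 ^ s + 2 ^ s - 1) = i - 2 ^ s + 2 ^ s"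
    using assms one_le_power[of "2 :: nat" s] by linarith+
  then show ?thesis
    unfolding ecr_alpha_def ecr_gamma_def by (simp only: shift prod.distrib)
qed

lemma prod_pCons_0: "(\<Prod>j\<in>A. [:f j:]) = [:\<Prod>j\<in>A. f j:]"
  by (induction A rule: infinite_finite_induct) (simp_all add: one_pCons mult.commute)

text \<open>The truncated \<open>s - 1\<close> and \<open>2 ^ s div 2\<close> make the formula cover \<open>s = 0\<close>, where the continuant is
  the empty one.\<close>

lemma ecr_shift_eq_eigencontinuant:
  assumes "2 ^ s div 2 \<le> i"
  shows "ecr_shift a b c s i =
    to_fract ((-1) ^ (s - 1) * eigencontinuant a b c (i + 1 - 2 ^ s div 2) (2 ^ s))"
  using assms
proof (induction s arbitrary: i rule: induct_nat_012)
  case 0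
  show ?case
    by (simp add: eigencontinuant_def)
next
  case 1
  then show ?case
    by (simp add: eigencontinuant_def eval_nat_numeral)
next
  case (ge2 s)
  define h :: nat where "h = 2 ^ s"
  define q where "q = h div 2"
  define l where "l = i + 1 - 2 * h"
  define K where "K = eigencontinuant a b c"
  define \<sigma> :: "real poly" where "\<sigma> = (-1) ^ (s - 1)"
  define \<tau> :: "real poly" where "\<tau> = (-1) ^ s"
  have h: "0 < h" and i: "i + 1 = l + 2 * h" "2 * h \<le> i" and q: "q \<le> h" "3 * q + q \<le> 2 * h"
    using ge2.prems by (simp_all add: h_def q_def l_def)
  have low: "ecr_shift a b c s x = to_fract (\<sigma> * K (x + 1 - q) h)" if "q \<le> x" for x
    using ge2.IH(1)[of x] that by (simp add: h_def q_def K_def \<sigma>_def)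
  have high: "ecr_shift a b c (Suc s) x = to_fract (\<tau> * K (x + 1 - h) (2 * h))" if "h \<le> x" for x
    using ge2.IH(2)[of x] that by (simp add: h_def K_def \<tau>_def)
  have low_eqs:
    "ecr_shift a b c s (i + q) = to_fract (\<sigma> * K (l + 2 * h) h)"
    "ecr_shift a b c s (i - q) = to_fract (\<sigma> * K (l + h) h)"
    "ecr_shift a b c s (i - 3 * q) = to_fract (\<sigma> * K l h)"
    "ecr_shift a b c s (i + 3 * q) = to_fract (\<sigma> * K (l + 3 * h) h)"
  proof -
    \<comment> \<open>For \<open>s = 0\<close> all these continuants are empty, whatever their
      start; otherwise \<open>h = 2 * q\<close> holds exactly and the starts agree.\<close>
    have "K (i + q + 1 - q) h = K (l + 2 * h) h \<and> K (i - q + 1 - q) h = K (l + h) h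
        \<and> K (i - 3 * q + 1 - q) h = K l h \<and> K (i + 3 * q + 1 - q) h = K (l + 3 * h) h"
    proof (cases s)
      case 0
      then show ?thesis
        by (simp add: h_def K_def eigencontinuant_def)
    next
      case (Suc s')
      then have "h = 2 * q"
        by (simp add: h_def q_def)
      then have "i + q + 1 - q = l + 2 * h" "i - q + 1 - q = l + h" "i - 3 * q + 1 - q = l"
        "i + 3 * q + 1 - q = l + 3 * h"
        using i by simp_all
      then show ?thesis
        by (simp only:)
    qed
    moreover have "q \<le> i + q" "q \<le> i - q" "q \<le> i - 3 * q" "q \<le> i + 3 * q"
      using i(2) q by simp_all
    ultimately show
      "ecr_shift a b c s (i + q) = to_fract (\<sigma> * K (l + 2 * h) h)"
      "ecr_shift a b c s (i - q) = to_fract (\<sigma> * K (l + h) h)"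
      "ecr_shift a b c s (i - 3 * q) = to_fract (\<sigma> * K l h)"
      "ecr_shift a b c s (i + 3 * q) = to_fract (\<sigma> * K (l + 3 * h) h)"
      by (simp_all only: low)
  qed
  have high_eqs:
    "ecr_shift a b c (Suc s) (i - h) = to_fract (\<tau> * K l (2 * h))"
    "ecr_shift a b c (Suc s) i = to_fract (\<tau> * K (l + h) (2 * h))"
    "ecr_shift a b c (Suc s) (i + h) = to_fract (\<tau> * K (l + 2 * h) (2 * h))"
  proof -
    have "i - h + 1 - h = l" "i + 1 - h = l + h" "i + h + 1 - h = l + 2 * h"
      "h \<le> i - h" "h \<le> i" "h \<le> i + h"
      using i by simp_all
    then show
      "ecr_shift a b c (Suc s) (i - h) = to_fract (\<tau> * K l (2 * h))"
      "ecr_shift a b c (Suc s) i = to_fract (\<tau> * K (l + h) (2 * h))"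
      "ecr_shift a b c (Suc s) (i + h) = to_fract (\<tau> * K (l + 2 * h) (2 * h))"
      by (simp_all only: high)
  qed
  define A where "A = [:ecr_alpha a s i * ecr_gamma c s (i - h):]"
  define B where "B = [:ecr_alpha a s (i + h) * ecr_gamma c s i:]"
  let ?e = "\<lambda>j. [:a j * c (j - 1):]"
  have A: "A = (\<Prod>j<h. ?e (l + h + j))"
  proof -
    have "i + 1 - h = l + h" "i - h = l + h - 1"
      using i by simp_all
    then show ?thesis
      using ecr_alpha_times_gamma[of s i a c] i h unfolding A_def prod_pCons_0 h_def[symmetric]
      by simp
  qed
  have B: "B = (\<Prod>j<h. ?e (l + 2 * h + j))"
  proof -
    have "i + h + 1 - h = l + 2 * h" "i + h - h = l + 2 * h - 1"
      using i by simp_all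
    then show ?thesis
      using ecr_alpha_times_gamma[of s "i + h" a c] i h unfolding B_def prod_pCons_0 h_def[symmetric]
      by (simp add: add_ac)
  qed
  have \<sigma>: "\<sigma> * \<sigma> = 1" and \<tau>: "\<tau> * \<tau> = 1"
    by (simp_all add: \<sigma>_def \<tau>_def flip: power_mult_distrib)
  have key: "K (l + h) h * K (l + 2 * h) h * K l (4 * h) =
      K l (2 * h) * K (l + h) (2 * h) * K (l + 2 * h) (2 * h)
      - A * K (l + 2 * h) h * K l h * K (l + 2 * h) (2 * h)
      - B * K (l + h) h * K (l + 3 * h) h * K l (2 * h)"
    unfolding A B K_def eigencontinuant_def by (rule continuant_cyclic_reduction[OF h])
  have D: "K (l + h) h * K (l + 2 * h) h \<noteq> 0"
    using h by (simp add: K_def eigencontinuant_nonzero)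
  \<comment> \<open>Each term carries \<open>\<sigma> * \<sigma> * \<tau>\<close> or
    \<open>\<tau> * \<tau> * \<tau>\<close>, that is \<open>\<tau>\<close>. With \<open>key\<close>,
    the sign flips once per level.\<close>
  let ?N = "A * (\<sigma> * K (l + 2 * h) h) * (\<sigma> * K l h) * (\<tau> * K (l + 2 * h) (2 * h))
      - (\<tau> * K l (2 * h)) * (\<tau> * K (l + h) (2 * h)) * (\<tau> * K (l + 2 * h) (2 * h))
      + B * (\<sigma> * K (l + h) h) * (\<sigma> * K (l + 3 * h) h) * (\<tau> * K l (2 * h))"
  have "?N = (\<sigma> * \<sigma>) * \<tau> * (A * K (l + 2 * h) h * K l h * K (l + 2 * h) (2 * h))
      - (\<tau> * \<tau>) * \<tau> * (K l (2 * h) * K (l + h) (2 * h) * K (l + 2 * h) (2 * h))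
      + (\<sigma> * \<sigma>) * \<tau> * (B * K (l + h) h * K (l + 3 * h) h * K l (2 * h))"
    by (simp only: mult_ac)
  also have "\<dots> = - \<tau> * K l (4 * h) * ((\<sigma> * \<sigma>) * (K (l + h) h * K (l + 2 * h) h))"
  proof -
    have "\<tau> * K l (4 * h) * (K (l + h) h * K (l + 2 * h) h) =
        \<tau> * (K (l + h) h * K (l + 2 * h) h * K l (4 * h))"
      by (simp only: mult_ac)
    then show ?thesis
      unfolding \<sigma> \<tau> key by (simp add: algebra_simps)
  qed
  finally have N: "?N = (- \<tau> * K l (4 * h)) * ((\<sigma> * K (l + h) h) * (\<sigma> * K (l + 2 * h) h))"
    by (simp only: mult_ac)
  have "ecr_shift a b c (Suc (Suc s)) i =
      to_fract ?N / to_fract ((\<sigma> * K (l + h) h) * (\<sigma> * K (l + 2 * h) h))"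
    unfolding ecr_shift.simps(3) Let_def h_def[symmetric] q_def[symmetric]
      low_eqs high_eqs A_def[symmetric] B_def[symmetric]
    by (simp only: to_fract_mult to_fract_add to_fract_diff)
  also have "\<dots> = to_fract (- \<tau> * K l (4 * h))"
  proof -
    have "(\<sigma> * K (l + h) h) * (\<sigma> * K (l + 2 * h) h) \<noteq> 0"
      using D by (simp add: \<sigma>_def)
    then show ?thesis
      unfolding N to_fract_mult[of "- \<tau> * K l (4 * h)"] by simp
  qed
  finally show ?case
    by (simp add: \<tau>_def K_def h_def l_def)
qed

section \<open>Evaluation at the matrix\<close>

lemma mat_poly_smult:
  fixes A :: "'a :: idom mat"
  assumes "A \<in> carrier_mat m m"
  shows "mat_poly (Polynomial.smult x p) A = x \<cdot>\<^sub>m mat_poly p A"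
\<comment> \<open>The sum in \<open>mat_poly\<close> stops at the degree, which \<open>smult\<close>
  preserves for nonzero \<open>x\<close>.\<close>
proof (cases "x = 0")
  case False
  then show ?thesis
    using assms by (intro eq_matI) (auto simp: mat_poly_def sum_distrib_left mult.assoc)
qed (use assms in \<open>auto simp: mat_poly_def\<close>)

theorem theorem3p1:
  fixes k n m r i j :: nat
    and a b c :: "nat \<Rightarrow> real"
    and B :: "real mat"
  assumes "k \<ge> 1" and "n = 2 ^ k - 1" and "m \<ge> 1"
    and "B \<in> carrier_mat m m" and "tridiagonal_mat B"
    and "a 1 = 0" and "c n = 0"
    and "r \<le> k - 1"
    and "1 \<le> j" and "j \<le> 2 ^ (k - r) - 1" and "i = j * 2 ^ r"
  shows "ecr_B a b c r i = to_fract ((-1) ^ r * eigenpoly a b c n r i)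
    \<and> ecr_B_mat a b c B r i = (-1) ^ r \<cdot>\<^sub>m mat_poly (eigenpoly a b c n r i) B"
proof -
  let ?p = "(-1) ^ r * eigenpoly a b c n r i"
  \<comment> \<open>As \<open>Suc n = 2 ^ k\<close>, the window around \<open>i\<close> ends inside
    the matrix.\<close>
  have "i + 2 ^ r \<le> 2 ^ k"
  proof -
    have "i + 2 ^ r = (j + 1) * 2 ^ r"
      using assms by simp
    also have "\<dots> \<le> 2 ^ (k - r) * 2 ^ r"
      using assms by (intro mult_right_mono) auto
    also have "\<dots> = 2 ^ k"
      using assms by (simp flip: power_add)
    finally show ?thesis .
  qed
  moreover have "2 ^ r \<le> i"
    using assms by simp
  ultimately have B: "ecr_B a b c r i = to_fract ?p"
    using assms ecr_shift_eq_eigencontinuant[of "Suc r" i a b c]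
    by (simp add: ecr_B_def eigenpoly_eq_eigencontinuant)
  have "?p = Polynomial.smult ((-1) ^ r) (eigenpoly a b c n r i)"
    by (cases "even r") simp_all
  moreover have "(THE p. to_fract p = ecr_B a b c r i) = ?p"
    unfolding B by (simp only: to_fract_eq_iff the_eq_trivial)
  ultimately show ?thesis
    using B mat_poly_smult[OF assms(4)] by (simp add: ecr_B_mat_def)
qed

end
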